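(* Let $n\ge 1$ and let $\{B_1,\ldots,B_n,Y_1,\ldots,Y_n\}$ be independent random variables, where $B_k$ is Bernoulli with success probability $1/k$ and $Y_k$ is non-negative with $E[Y_k]=k$ and $\mathrm{Var}(Y_k)=\sigma_k^2<\infty$ for $k=1,\ldots,n$. Let $$W_n=\frac1n\sum_{k=1}^n Y_kB_k,$$ and let $D$ be a standard Dickman random variable. Then $$d_{1,1}(W_n,D)\le \frac{3}{4n}+\frac{1}{2n^2}\sum_{k=1}^n\frac1k\sqrt{(\sigma_k^2+k^2)\sigma_k^2}.$$ In particular, if $Y_k=k$ almost surely for all $k$, i.e. $W_n=\frac1n\sum_{k=1}^n kB_k$, then $$d_{1,1}(W_n,D)\le\frac{3}{4n}.$$
   Context: For $\theta>0$, the generalized Dickman distribution $\mathcal{D}_\theta$ is the unique law of a non-negative random variable $W$ satisfying $W=_d U^{1/\theta}(W+1)$, where $U\sim\mathcal{U}[0,1]$ is independent of $W$ and $=_d$ is equality in distribution. The standard Dickman distribution is $\mathcal{D}=\mathcal{D}_1$. For $\alpha\ge 0$, $\mathrm{Lip}_\alpha$ is the set of real-valued functions $h$ with $|h(x)-h(y)|\le\alpha|x-y|$ for all $x,y$. For $\alpha,\beta\ge0$, $\mathcal{H}_{\alpha,\beta}$ is the set of differentiable functions $h:[0,\infty)\to\mathbb{R}$ with $h\in\mathrm{Lip}_\alpha$ and $h'\in\mathrm{Lip}_\beta$. For non-negative random variables $X,Y$, $d_{1,1}(X,Y)=\sup_{h\in\mathcal{H}_{1,1}}|E h(Y)-E h(X)|$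 (a distance between the laws of $X$ and $Y$). *)

theory Defs
  imports "HOL-Probability.Probability"
begin

text \<open>
  A law \<open>\<mu>\<close> on the reals is generalized Dickman with parameter \<open>\<theta> > 0\<close> if it is the law of a
  non-negative \<open>W\<close> with \<open>W\<close> equal in distribution to \<open>U powr (1 / \<theta>) * (W + 1)\<close>. The product
  measure encodes that \<open>U\<close> is uniform on the unit interval and independent of \<open>W\<close>. Exactly one
  law satisfies this, so the notion is given as a predicate.
\<close>
definition dickman_law :: "real \<Rightarrow> real measure \<Rightarrow> bool" where
  "dickman_law \<theta> \<mu> \<longleftrightarrow>
     0 < \<theta> \<and> prob_space \<mu> \<and> sets \<mu> = sets borel \<and> (AE x in \<mu>. 0 \<le> x) \<and>
     distr (uniform_measure lborel {0..1} \<Otimes>\<^sub>M \<mu>) borel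
       (\<lambda>(u, w). u powr (1 / \<theta>) * (w + 1)) = \<mu>"

text \<open>
  Functions with domain \<open>[0, \<infinity>)\<close> are rendered as functions extensional on \<open>{0..}\<close>. The constant
  value on the negative axis makes them Borel measurable on the whole line, and plays no role
  for almost surely non-negative random variables. The derivative at \<open>0\<close> is one-sided.
\<close>
definition H_class :: "real \<Rightarrow> real \<Rightarrow> (real \<Rightarrow> real) set" where
  "H_class \<alpha> \<beta> = {h. h \<in> extensional {0..} \<and> \<alpha>-lipschitz_on {0..} h \<and>
     (\<exists>h'. (\<forall>x\<in>{0..}. (h has_real_derivative h' x) (at x within {0..})) \<and>
           \<beta>-lipschitz_on {0..} h')}"

text \<open>
  The random variables may live on different probability spaces. The supremum is taken in the
  extended reals, so that it is meaningful without a boundedness argument.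
\<close>
definition d11 :: "'a measure \<Rightarrow> ('a \<Rightarrow> real) \<Rightarrow> 'b measure \<Rightarrow> ('b \<Rightarrow> real) \<Rightarrow> ereal" where
  "d11 M X N Y =
     (SUP h\<in>H_class 1 1. ereal \<bar>(\<integral>\<omega>. h (Y \<omega>) \<partial>N) - (\<integral>\<omega>. h (X \<omega>) \<partial>M)\<bar>)"

end

theory Submission
  imports Defs
begin

text \<open>
  The proof is Stein's method for the standard Dickman law \<open>\<mu>\<close>, with the Stein equation replaced by
  an iteration. Write \<open>A h x\<close> for the mean of \<open>h\<close> over the segment from \<open>0\<close> to \<open>x\<close>, that is
  \<open>E h (U x)\<close> with \<open>U\<close> uniform on the unit interval. The fixed point property of \<open>\<mu>\<close> says that the integral of \<open>h\<close> against \<open>\<mu>\<close> equals that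
  of \<open>T h x = A h (x + 1)\<close> (\<open>dickman_invariance\<close>). Since \<open>h x = f x + x f' x\<close> for \<open>f = A h\<close>
  (\<open>avg_identity\<close>), for every integrable \<open>W\<close>
  \<open>E h(W) - E (T h)(W) = E [W f' W] - (E f (W + 1) - E f W)\<close>.
  The right-hand side is a Stein functional; suppose that it is at most \<open>L K\<close> in absolute value
  whenever \<open>f'\<close> is \<open>L\<close>-Lipschitz.

  Differentiating \<open>h (u x)\<close> in \<open>x\<close> brings out a factor \<open>u\<close>, and a second factor \<open>u\<close> comes from the
  Lipschitz estimate for \<open>h'\<close>. Hence \<open>A\<close> divides Lipschitz constants of \<open>h\<close> by \<open>2\<close> and those of \<open>h'\<close>
  by \<open>3\<close> (\<open>C11_avg\<close>). Replacing \<open>h\<close> by \<open>T h\<close> again and again therefore costs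
  \<open>K/3 + K/9 + K/27 + \<dots> = K/2\<close> in total, while the Lipschitz constant of the iterates, and
  with it the remaining distance between their integrals, tends to \<open>0\<close>
  (\<open>dickman_stein_bound\<close>). This last point uses that \<open>\<mu>\<close> has a finite mean
  (\<open>dickman_integrable\<close>).

  For the weighted Bernoulli sum \<open>W\<close>, the constant is
  \<open>K = 3/(2n) + 1/n\<^sup>2 \<Sum> 1/k sqrt ((\<sigma>\<^sub>k\<^sup>2 + k\<^sup>2) \<sigma>\<^sub>k\<^sup>2)\<close> (\<open>weighted_sum_stein\<close>).
  Let \<open>V\<^sub>k\<close> be \<open>W\<close> without its \<open>k\<close>-th summand, so that \<open>E [W f' W]\<close> is the average over \<open>k\<close> of
  \<open>E [Y\<^sub>k B\<^sub>k f' (V\<^sub>k + Y\<^sub>k/n)]\<close>. Three replacements lead from there to the increment of \<open>f\<close>: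
  \<^item> \<open>Y\<^sub>k/n\<close> by \<open>k/n\<close> inside \<open>f'\<close>, at the price \<open>L/n E [B\<^sub>k Y\<^sub>k \<bar>Y\<^sub>k - k\<bar>]\<close>, which the
    Cauchy-Schwarz inequality bounds by the square root terms; by independence and
    \<open>E [B\<^sub>k Y\<^sub>k] = 1\<close>, what is left is \<open>E f' (V\<^sub>k + k/n)\<close>;
  \<^item> \<open>V\<^sub>k\<close> by \<open>W\<close>, at the price \<open>L/n E [B\<^sub>k Y\<^sub>k] = L/n\<close>;
  \<^item> \<open>f' (W + k/n)\<close> by the difference quotient \<open>n (f (W + k/n) - f (W + (k-1)/n))\<close>, at the price
    \<open>L/(2n)\<close> by Taylor's formula.

  The difference quotients telescope to \<open>f (W + 1) - f W\<close>, and \<open>K/2\<close> is the asserted bound.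
\<close>

section \<open>Functions with bounded Lipschitz derivative\<close>

text \<open>
  The functions live on the whole line rather than on \<open>{0..}\<close>, so that no one-sided derivatives occur
  and every real random variable can be inserted. The derivative is a parameter because the
  averaging operator acts on it by a formula of its own.
\<close>
definition C11 :: "real \<Rightarrow> real \<Rightarrow> (real \<Rightarrow> real) \<Rightarrow> (real \<Rightarrow> real) \<Rightarrow> bool" where
  "C11 a b h h' \<longleftrightarrow>
     (\<forall>x. (h has_real_derivative h' x) (at x)) \<and> (\<forall>x. \<bar>h' x\<bar> \<le> a) \<and>
     (\<forall>x y. \<bar>h' x - h' y\<bar> \<le> b * \<bar>x - y\<bar>)"

lemma C11_nonneg: "C11 a b h h' \<Longrightarrow> 0 \<le> a" "C11 a b h h' \<Longrightarrow> 0 \<le> b"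
proof -
  assume h: "C11 a b h h'"
  have "\<bar>h' 0\<bar> \<le> a" "\<bar>h' 1 - h' 0\<bar> \<le> b * \<bar>1 - 0\<bar>" using h unfolding C11_def by blast+
  then show "0 \<le> a" "0 \<le> b" by auto
qed

lemma C11_continuous:
  assumes "C11 a b h h'"
  shows "continuous_on S h" "continuous_on S h'"
proof -
  show "continuous_on S h"
    using assms unfolding C11_def
    by (meson DERIV_isCont continuous_at_imp_continuous_on)
  have "b-lipschitz_on S h'"
    using assms C11_nonneg[OF assms] unfolding C11_def lipschitz_on_def dist_real_def by auto
  then show "continuous_on S h'" by (rule lipschitz_on_continuous_on)
qed

lemma C11_continuous_compose:
  assumes "C11 a b h h'" and "continuous_on S g"
  shows "continuous_on S (\<lambda>x. h (g x))" "continuous_on S (\<lambda>x. h' (g x))"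
  using continuous_on_compose2[OF C11_continuous(1)[OF assms(1), of UNIV] assms(2)]
    continuous_on_compose2[OF C11_continuous(2)[OF assms(1), of UNIV] assms(2)] by auto

lemma C11_measurable:
  assumes "C11 a b h h'"
  shows "h \<in> borel_measurable borel" "h' \<in> borel_measurable borel"
  using C11_continuous[OF assms] by (auto intro: borel_measurable_continuous_onI)

lemma C11_lipschitz:
  assumes "C11 a b h h'"
  shows "\<bar>h x - h y\<bar> \<le> a * \<bar>x - y\<bar>"
  using field_differentiable_bound[of UNIV h h' a x y] assms
  unfolding C11_def by (auto simp: has_field_derivative_at_within abs_minus_commute)

lemma C11_integrable:
  assumes h: "C11 a b h h'" and M: "prob_space M" and X: "integrable M (X :: _ \<Rightarrow> real)"
  shows "integrable M (\<lambda>\<omega>. h (X \<omega>))" "integrable M (\<lambda>\<omega>. h' (X \<omega>))"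
    "integrable M (\<lambda>\<omega>. h' (X \<omega>) * X \<omega>)"
proof -
  interpret prob_space M by fact
  note [measurable] = C11_measurable[OF h] borel_measurable_integrable[OF X]
  show "integrable M (\<lambda>\<omega>. h (X \<omega>))"
  proof (rule Bochner_Integration.integrable_bound)
    show "integrable M (\<lambda>\<omega>. \<bar>h 0\<bar> + a * \<bar>X \<omega>\<bar>)" using X by auto
    have "norm (h x) \<le> norm (\<bar>h 0\<bar> + a * \<bar>x\<bar>)" for x
      using C11_lipschitz[OF h, of x 0] by auto
    then show "AE \<omega> in M. norm (h (X \<omega>)) \<le> norm (\<bar>h 0\<bar> + a * \<bar>X \<omega>\<bar>)" by auto
  qed measurable
  show "integrable M (\<lambda>\<omega>. h' (X \<omega>))"
    by (rule integrable_const_bound[where B = a]) (use h in \<open>auto simp: C11_def\<close>)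
  show "integrable M (\<lambda>\<omega>. h' (X \<omega>) * X \<omega>)"
  proof (rule Bochner_Integration.integrable_bound)
    show "integrable M (\<lambda>\<omega>. a * X \<omega>)" using X by auto
    have "\<bar>h' x\<bar> \<le> a" "0 \<le> a" for x using h C11_nonneg[OF h] by (auto simp: C11_def)
    then show "AE \<omega> in M. norm (h' (X \<omega>) * X \<omega>) \<le> norm (a * X \<omega>)"
      by (auto simp: abs_mult mult_right_mono)
  qed measurable
qed

text \<open>
  The function \<open>f t - f' y * t + L * (t - y)\<^sup>2 / 2\<close> is nonincreasing to the left of \<open>y\<close>, because there
  \<open>f' t - f' y\<close> is at most \<open>L * (y - t)\<close>.
\<close>
lemma taylor_one_sided:
  fixes f f' :: "real \<Rightarrow> real"
  assumes f: "\<And>x. (f has_real_derivative f' x) (at x)"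
    and f': "\<And>x y. \<bar>f' x - f' y\<bar> \<le> L * \<bar>x - y\<bar>"
    and d: "0 \<le> d"
  shows "f y - f (y - d) - d * f' y \<le> L * d\<^sup>2 / 2"
proof -
  have "f y - f' y * y + L * (y - y)\<^sup>2 / 2 \<le> f (y - d) - f' y * (y - d) + L * ((y - d) - y)\<^sup>2 / 2"
  proof (rule DERIV_nonpos_imp_nonincreasing[where f = "\<lambda>t. f t - f' y * t + L * (t - y)\<^sup>2 / 2"])
    show "y - d \<le> y" using d by simp
    fix t assume t: "y - d \<le> t" "t \<le> y"
    have "((\<lambda>t. f t - f' y * t + L * (t - y)\<^sup>2 / 2) has_real_derivative
           f' t - f' y + L * (t - y)) (at t)"
      by (auto intro!: derivative_eq_intros f)
    moreover have "f' t - f' y + L * (t - y) \<le> 0"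
      using f'[of t y] t by (auto simp: algebra_simps)
    ultimately show "\<exists>z. ((\<lambda>t. f t - f' y * t + L * (t - y)\<^sup>2 / 2) has_real_derivative z) (at t) \<and> z \<le> 0"
      by blast
  qed
  then show ?thesis by (simp add: algebra_simps)
qed

lemma C11_taylor:
  assumes f: "C11 a L f f'" and d: "0 \<le> d"
  shows "\<bar>f y - f (y - d) - d * f' y\<bar> \<le> L * d\<^sup>2 / 2"
proof -
  have "f y - f (y - d) - d * f' y \<le> L * d\<^sup>2 / 2"
    by (rule taylor_one_sided) (use f d in \<open>auto simp: C11_def\<close>)
  moreover have "(\<lambda>x. - f x) y - (\<lambda>x. - f x) (y - d) - d * (\<lambda>x. - f' x) y \<le> L * d\<^sup>2 / 2"
    by (rule taylor_one_sided)
      (use f d in \<open>auto simp: C11_def abs_minus_commute intro!: derivative_eq_intros\<close>)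
  ultimately show ?thesis by (simp add: abs_if)
qed

text \<open>
  Continue \<open>h\<close> to the left of \<open>0\<close> by its tangent at \<open>0\<close>. The derivative of the extension at \<open>x\<close> is
  then \<open>h' (max 0 x)\<close>, which inherits the Lipschitz constant of \<open>h'\<close>.
\<close>
lemma H_class_extends:
  assumes h: "h \<in> H_class 1 1"
  obtains g g' where "C11 1 1 g g'" "\<And>x. 0 \<le> x \<Longrightarrow> g x = h x"
proof -
  from h obtain h' where
    h1: "1-lipschitz_on {0..} h"
    and d: "\<And>x. 0 \<le> x \<Longrightarrow> (h has_real_derivative h' x) (at x within {0..})"
    and h2: "1-lipschitz_on {0..} h'"
    unfolding H_class_def by fastforce
  define g where "g x = (if 0 \<le> x then h x else h 0 + h' 0 * x)" for x
  define g' where "g' x = h' (max 0 x)" for x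
  \<comment> \<open>The derivative is a limit of difference quotients, which the Lipschitz property of \<open>h\<close> bounds.\<close>
  have bound: "\<bar>h' x\<bar> \<le> 1" if x: "0 \<le> x" for x
  proof (rule tendsto_upperbound)
    show "((\<lambda>y. \<bar>(h y - h x) / (y - x)\<bar>) \<longlongrightarrow> \<bar>h' x\<bar>) (at x within {0..})"
      using d[OF x] unfolding has_field_derivative_iff by (rule tendsto_rabs)
    have "\<bar>(h y - h x) / (y - x)\<bar> \<le> 1" if "y \<noteq> x" "0 \<le> y" for y
      using lipschitz_onD[OF h1, of y x] x that by (auto simp: dist_real_def abs_divide divide_le_eq)
    then show "\<forall>\<^sub>F y in at x within {0..}. \<bar>(h y - h x) / (y - x)\<bar> \<le> 1"
      by (auto simp: eventually_at_filter)
    have "at x within {x<..} \<le> at x within {0..}" using x by (intro at_le) auto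
    moreover have "at x within {x<..} \<noteq> bot" by (rule trivial_limit_at_right_real)
    ultimately show "at x within {0..} \<noteq> bot" by (metis bot.extremum_uniqueI)
  qed
  have "(g has_real_derivative g' x) (at x)" for x
  proof (cases x "0 :: real" rule: linorder_cases)
    case greater
    have "at x within {0..} = at x" using greater by (intro at_within_interior) (simp add: interior_real_atLeast)
    then have "(h has_real_derivative h' x) (at x)" using d[of x] greater by simp
    then have "(g has_real_derivative h' x) (at x)"
      by (rule has_field_derivative_transform_within_open[where S = "{0<..}"]) (use greater in \<open>auto simp: g_def\<close>)
    then show ?thesis using greater by (simp add: g'_def)
  next
    case less
    have "((\<lambda>x. h 0 + h' 0 * x) has_real_derivative h' 0) (at x)"
      by (auto intro!: derivative_eq_intros)
    then have "(g has_real_derivative h' 0) (at x)"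
      by (rule has_field_derivative_transform_within_open[where S = "{..<0}"]) (use less in \<open>auto simp: g_def\<close>)
    then show ?thesis using less by (simp add: g'_def)
  next
    case equal
    have "(g has_real_derivative h' 0) (at 0 within {0..})"
      by (rule has_field_derivative_transform_within[OF d[of 0], of 1]) (auto simp: g_def)
    moreover have "((\<lambda>x. h 0 + h' 0 * x) has_real_derivative h' 0) (at 0 within {..0})"
      by (auto intro!: derivative_eq_intros)
    then have "(g has_real_derivative h' 0) (at 0 within {..0})"
      by (rule has_field_derivative_transform_within[where d = 1]) (auto simp: g_def)
    ultimately have "(g has_real_derivative h' 0) (at 0 within ({0..} \<union> {..0}))"
      unfolding has_field_derivative_iff Lim_within_Un by blast
    moreover have "{0..} \<union> {..0} = (UNIV :: real set)" by auto
    ultimately show ?thesis using equal by (simp add: g'_def)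
  qed
  moreover have "\<bar>g' x\<bar> \<le> 1" for x unfolding g'_def by (rule bound) simp
  moreover have "\<bar>g' x - g' y\<bar> \<le> 1 * \<bar>x - y\<bar>" for x y
  proof -
    have "\<bar>g' x - g' y\<bar> \<le> \<bar>max 0 x - max 0 y\<bar>"
      using lipschitz_onD[OF h2, of "max 0 x" "max 0 y"] by (simp add: g'_def dist_real_def)
    also have "\<dots> \<le> \<bar>x - y\<bar>" by (simp add: max_def abs_if)
    finally show ?thesis by simp
  qed
  ultimately have "C11 1 1 g g'" by (auto simp: C11_def)
  then show thesis by (rule that) (simp add: g_def)
qed

section \<open>Averaging over the segment to the origin\<close>

text \<open>
  This is \<open>E h (U x)\<close> for \<open>U\<close> uniform on the unit interval. By \<open>W = U (W + 1)\<close> in distribution, the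
  Dickman law gives the same integral to \<open>h\<close> and to \<open>x \<mapsto> avg h (x + 1)\<close>.
\<close>
definition avg :: "(real \<Rightarrow> real) \<Rightarrow> real \<Rightarrow> real" where
  "avg h x = integral {0..1} (\<lambda>u. h (u * x))"

text \<open>
  The derivative of \<open>avg h\<close> when \<open>k\<close> is the derivative of \<open>h\<close>.
\<close>
definition wavg :: "(real \<Rightarrow> real) \<Rightarrow> real \<Rightarrow> real" where
  "wavg k x = integral {0..1} (\<lambda>u. u * k (u * x))"

lemma integral_power_unit:
  "integral {0..1} (\<lambda>u::real. c * u ^ n) = c / real (Suc n)"
  "(\<lambda>u::real. c * u ^ n) integrable_on {0..1}"
proof -
  have "((\<lambda>u::real. c * u ^ n) has_integral
      (c * 1 ^ Suc n / real (Suc n) - c * 0 ^ Suc n / real (Suc n))) {0..1}"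
  proof (rule fundamental_theorem_of_calculus)
    fix x :: real
    have "((\<lambda>u. c * u ^ Suc n / real (Suc n)) has_real_derivative c * x ^ n) (at x within {0..1})"
      by (rule derivative_eq_intros refl | simp)+
    then show "((\<lambda>u. c * u ^ Suc n / real (Suc n)) has_vector_derivative c * x ^ n) (at x within {0..1})"
      by (simp add: has_real_derivative_iff_has_vector_derivative)
  qed simp
  then show "integral {0..1} (\<lambda>u::real. c * u ^ n) = c / real (Suc n)"
    "(\<lambda>u::real. c * u ^ n) integrable_on {0..1}"
    by (auto simp del: integral_mult_right simp: has_integral_iff)
qed

text \<open>
  The mean of \<open>u\<close> over the unit interval is \<open>1/2\<close> and that of \<open>u\<^sup>2\<close> is \<open>1/3\<close>: these are the
  contraction factors on which the whole iteration rests.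
\<close>
lemma C11_avg:
  assumes h: "C11 a b h h'"
  shows "C11 (a / 2) (b / 3) (avg h) (wavg h')"
proof -
  note [continuous_intros] = C11_continuous_compose[OF h]
  have int: "(\<lambda>u. u * h' (u * x)) integrable_on {0..1}" for x
    by (intro integrable_continuous_interval continuous_intros)
  have D: "(avg h has_real_derivative wavg h' x) (at x)" for x
  proof -
    have "((\<lambda>x. integral (cbox 0 1) (\<lambda>u. h (u * x))) has_field_derivative
          integral (cbox 0 1) (\<lambda>u. u * h' (u * x))) (at x within UNIV)"
    proof (rule leibniz_rule_field_derivative)
      fix x u :: real
      have "(h has_real_derivative h' (u * x)) (at (u * x))" using h by (auto simp: C11_def)
      from DERIV_chain2[where f = h and g = "\<lambda>x. u * x" and x = x, OF this, of u UNIV]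
      moreover have "((\<lambda>x. u * x) has_real_derivative u) (at x within UNIV)"
        by (auto intro!: derivative_eq_intros)
      ultimately show "((\<lambda>x. h (u * x)) has_real_derivative u * h' (u * x)) (at x within UNIV)"
        by (simp only: mult.commute)
    qed (auto simp: split_beta intro!: continuous_intros integrable_continuous_interval)
    then show ?thesis unfolding avg_def[abs_def] wavg_def by simp
  qed
  have B: "\<bar>wavg h' x\<bar> \<le> a / 2" for x
  proof -
    have "norm (integral {0..1} (\<lambda>u. u * h' (u * x))) \<le> integral {0..1} (\<lambda>u::real. a * u ^ 1)"
      by (rule integral_norm_bound_integral[OF int integral_power_unit(2)])
        (use h in \<open>auto simp: C11_def abs_mult mult.commute intro!: mult_left_mono\<close>)
    then show ?thesis unfolding wavg_def integral_power_unit(1) by simp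
  qed
  have L: "\<bar>wavg h' x - wavg h' y\<bar> \<le> b / 3 * \<bar>x - y\<bar>" for x y
  proof -
    have *: "norm (u * h' (u * x) - u * h' (u * y)) \<le> (b * \<bar>x - y\<bar>) * u ^ 2"
      if "u \<in> {0..1}" for u
    proof -
      have "\<bar>h' (u * x) - h' (u * y)\<bar> \<le> b * \<bar>u * x - u * y\<bar>" using h by (auto simp: C11_def)
      also have "\<bar>u * x - u * y\<bar> = u * \<bar>x - y\<bar>"
        using that by (metis abs_mult abs_of_nonneg atLeastAtMost_iff right_diff_distrib)
      finally have "u * \<bar>h' (u * x) - h' (u * y)\<bar> \<le> u * (b * (u * \<bar>x - y\<bar>))"
        using that by (intro mult_left_mono) auto
      moreover have "norm (u * h' (u * x) - u * h' (u * y)) = u * \<bar>h' (u * x) - h' (u * y)\<bar>"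
        using that by (simp add: abs_mult flip: right_diff_distrib)
      ultimately show ?thesis by (simp add: power2_eq_square algebra_simps)
    qed
    have "norm (integral {0..1} (\<lambda>u. u * h' (u * x) - u * h' (u * y)))
        \<le> integral {0..1} (\<lambda>u::real. (b * \<bar>x - y\<bar>) * u ^ 2)"
      by (rule integral_norm_bound_integral[OF _ integral_power_unit(2) *])
        (intro integrable_diff int)
    also have "integral {0..1} (\<lambda>u. u * h' (u * x) - u * h' (u * y)) = wavg h' x - wavg h' y"
      unfolding wavg_def by (intro integral_diff int)
    finally show ?thesis unfolding integral_power_unit(1) by simp
  qed
  show ?thesis using D B L by (auto simp: C11_def)
qed

text \<open>
  Integrate the derivative of \<open>u * h (u * x)\<close> in \<open>u\<close> from \<open>0\<close> to \<open>1\<close>. The identity says that \<open>avg h\<close>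
  solves \<open>f x + x * f' x = h x\<close>, which links \<open>h\<close> to the Stein functional of \<open>avg h\<close>.
\<close>
lemma avg_identity:
  assumes h: "C11 a b h h'"
  shows "h x = avg h x + x * wavg h' x"
proof -
  note [continuous_intros] = C11_continuous_compose[OF h]
  have "((\<lambda>u. h (u * x) + x * (u * h' (u * x))) has_integral 1 * h (1 * x) - 0 * h (0 * x)) {0..1}"
  proof (rule fundamental_theorem_of_calculus)
    fix u :: real
    have "(h has_real_derivative h' (u * x)) (at (u * x))" using h by (auto simp: C11_def)
    from DERIV_chain2[where f = h and g = "\<lambda>u. u * x" and x = u, OF this, of x "{0..1}"]
    moreover have "((\<lambda>u. u * x) has_real_derivative x) (at u within {0..1})"
      by (auto intro!: derivative_eq_intros)
    ultimately have "((\<lambda>u. h (u * x)) has_real_derivative h' (u * x) * x) (at u within {0..1})"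
      by blast
    then have "((\<lambda>u. u * h (u * x)) has_real_derivative h (u * x) + x * (u * h' (u * x)))
        (at u within {0..1})"
      by (auto intro!: derivative_eq_intros)
    then show "((\<lambda>u. u * h (u * x)) has_vector_derivative h (u * x) + x * (u * h' (u * x)))
        (at u within {0..1})"
      by (simp add: has_real_derivative_iff_has_vector_derivative)
  qed simp
  then have "integral {0..1} (\<lambda>u. h (u * x) + x * (u * h' (u * x))) = h x"
    by (simp add: integral_unique)
  moreover have "integral {0..1} (\<lambda>u. h (u * x) + x * (u * h' (u * x))) = avg h x + x * wavg h' x"
    unfolding avg_def wavg_def
    by (subst integral_add) (auto intro!: integrable_continuous_interval continuous_intros)
  ultimately show ?thesis by simp
qed

lemma C11_shift:
  "C11 a b f f' \<Longrightarrow> C11 a b (\<lambda>x. f (x + c)) (\<lambda>x. f' (x + c))"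
proof -
  assume f: "C11 a b f f'"
  have "((\<lambda>x. f (x + c)) has_real_derivative f' (x + c)) (at x)" for x
    using f DERIV_shift[of f "f' (x + c)" x c] unfolding C11_def by blast
  moreover have "\<bar>f' (x + c) - f' (y + c)\<bar> \<le> b * \<bar>x - y\<bar>" for x y
  proof -
    have "\<bar>f' (x + c) - f' (y + c)\<bar> \<le> b * \<bar>(x + c) - (y + c)\<bar>"
      using f unfolding C11_def by blast
    then show ?thesis by simp
  qed
  ultimately show ?thesis using f by (auto simp: C11_def)
qed

section \<open>The Dickman law as a fixed point\<close>

text \<open>
  This is the equation \<open>W = U (W + 1)\<close> in distribution, integrated against \<open>\<phi>\<close> by Fubini's theorem.
\<close>
lemma dickman_invariance:
  assumes \<mu>: "dickman_law 1 \<mu>" and c: "continuous_on UNIV \<phi>" and i: "integrable \<mu> \<phi>"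
  shows "integrable \<mu> (\<lambda>w. avg \<phi> (w + 1))" "(\<integral>w. avg \<phi> (w + 1) \<partial>\<mu>) = (\<integral>w. \<phi> w \<partial>\<mu>)"
proof -
  let ?U = "uniform_measure lborel {0..1::real}"
  let ?G = "\<lambda>(u, w). u powr (1 / 1) * (w + 1) :: real"
  have s [measurable_cong]: "sets \<mu> = sets borel" and p: "prob_space \<mu>"
    and inv: "distr (?U \<Otimes>\<^sub>M \<mu>) borel ?G = \<mu>"
    using \<mu> unfolding dickman_law_def by auto
  interpret \<mu>: prob_space \<mu> by fact
  interpret U: prob_space ?U by (rule prob_space_uniform_measure) auto
  interpret pair_sigma_finite ?U \<mu> ..
  have [measurable]: "\<phi> \<in> borel_measurable borel" using c by (rule borel_measurable_continuous_onI)
  have G [measurable]: "?G \<in> borel_measurable (?U \<Otimes>\<^sub>M \<mu>)" by measurable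
  have "integrable (distr (?U \<Otimes>\<^sub>M \<mu>) borel ?G) \<phi>" using i unfolding inv .
  then have int: "integrable (?U \<Otimes>\<^sub>M \<mu>) (\<lambda>x. \<phi> (?G x))" by (rule integrable_distr[OF G])
  have eq: "(\<lambda>x. \<phi> (?G x)) = case_prod (\<lambda>u w. \<phi> (u powr (1 / 1) * (w + 1)))" by auto
  have U_density: "?U = density lborel (\<lambda>x. ennreal (indicator {0..1} x))"
    unfolding uniform_measure_def by (intro density_cong) (auto split: split_indicator)
  have avg: "(\<integral>u. \<phi> (u powr (1 / 1) * (w + 1)) \<partial>?U) = avg \<phi> (w + 1)" for w
  proof -
    have cw: "continuous_on {0..1} (\<lambda>u. \<phi> (u * (w + 1)))"
      by (intro continuous_on_compose2[OF c] continuous_intros) auto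
    have "(\<integral>u. \<phi> (u powr (1 / 1) * (w + 1)) \<partial>?U) = (\<integral>u. \<phi> (u * (w + 1)) \<partial>?U)"
    proof (rule integral_cong_AE)
      show "AE u in ?U. \<phi> (u powr (1 / 1) * (w + 1)) = \<phi> (u * (w + 1))"
        by (rule AE_uniform_measureI) auto
    qed measurable
    also have "\<dots> = (LINT u:{0..1}|lborel. \<phi> (u * (w + 1)))"
      unfolding set_lebesgue_integral_def U_density by (subst integral_density) auto
    also have "\<dots> = avg \<phi> (w + 1)"
      unfolding avg_def
      by (rule set_borel_integral_eq_integral) (rule borel_integrable_atLeastAtMost'[OF cw])
    finally show ?thesis .
  qed
  show "integrable \<mu> (\<lambda>w. avg \<phi> (w + 1))"
    using integrable_snd[OF int[unfolded eq]] unfolding avg .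
  have "(\<integral>w. avg \<phi> (w + 1) \<partial>\<mu>) = (\<integral>x. \<phi> (?G x) \<partial>(?U \<Otimes>\<^sub>M \<mu>))"
    using integral_snd[OF int[unfolded eq]] unfolding avg eq .
  also have "\<dots> = (\<integral>w. \<phi> w \<partial>distr (?U \<Otimes>\<^sub>M \<mu>) borel ?G)"
    by (rule integral_distr[symmetric]) measurable
  finally show "(\<integral>w. avg \<phi> (w + 1) \<partial>\<mu>) = (\<integral>w. \<phi> w \<partial>\<mu>)" unfolding inv .
qed

text \<open>
  Jensen's inequality for the concave function \<open>y \<mapsto> min m y\<close>.
\<close>
lemma avg_min_affine_le:
  "avg (\<lambda>x. min m (a * x + b)) x \<le> min m (a / 2 * x + b)"
proof -
  have I: "(\<lambda>u. min m (a * (u * x) + b)) integrable_on {0..1}"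
    by (intro integrable_continuous_interval continuous_intros)
  have "avg (\<lambda>x. min m (a * x + b)) x \<le> integral {0..1} (\<lambda>u::real. m)"
    unfolding avg_def by (rule integral_le[OF I]) auto
  moreover have "((\<lambda>u. a * x * u ^ 1 + b * u ^ 0) integrable_on {0..1})"
    by (intro integrable_add integral_power_unit)
  then have "avg (\<lambda>x. min m (a * x + b)) x \<le> integral {0..1} (\<lambda>u. a * x * u ^ 1 + b * u ^ 0)"
    unfolding avg_def by (intro integral_le[OF I]) (auto simp: mult_ac)
  moreover have "integral {0..1} (\<lambda>u. a * x * u ^ 1 + b * u ^ 0) = a * x / 2 + b"
    by (subst integral_add) (simp_all only: integral_power_unit, simp)
  ultimately show ?thesis by simp
qed

text \<open>
  The fixed point equation alone gives \<open>E W = (E W + 1) / 2\<close> in the extended sense, which leaves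
  \<open>\<infinity>\<close> as a possible value. Truncation excludes it: by invariance and Jensen's inequality,
  \<open>E min m (a W + b)\<close> is at most \<open>E min m ((a/2) W + (b + a/2))\<close>. Iterated from \<open>a = 1\<close> and \<open>b = 0\<close>, this
  shrinks the coefficient of \<open>W\<close> to \<open>0\<close> while the constant stays below \<open>1\<close>. Dominated convergence
  gives \<open>E min m W \<le> 1\<close>, and monotone convergence in \<open>m\<close> completes the proof.
\<close>
lemma dickman_integrable:
  assumes \<mu>: "dickman_law 1 \<mu>"
  shows "integrable \<mu> (\<lambda>x. x)"
proof -
  have s [measurable_cong]: "sets \<mu> = sets borel" and p: "prob_space \<mu>"
    and nn: "AE x in \<mu>. 0 \<le> x"
    using \<mu> unfolding dickman_law_def by auto
  interpret prob_space \<mu> by fact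
  have int: "integrable \<mu> (\<lambda>x. min m (a * x + b))" if "0 \<le> a" "0 \<le> b" "0 \<le> m" for a b m :: real
    by (rule integrable_const_bound[where B = m]) (use nn that in auto)
  have halve: "(\<integral>x. min m (a * x + b) \<partial>\<mu>) \<le> (\<integral>x. min m (a / 2 * x + (b + a / 2)) \<partial>\<mu>)"
    if "0 \<le> a" "0 \<le> b" "0 \<le> m" for a b m
  proof -
    note inv = dickman_invariance[OF \<mu> _ int[OF that]]
    have c: "continuous_on UNIV (\<lambda>x. min m (a * x + b))" by (intro continuous_intros)
    have "(\<integral>x. min m (a * x + b) \<partial>\<mu>) = (\<integral>x. avg (\<lambda>x. min m (a * x + b)) (x + 1) \<partial>\<mu>)"
      by (rule inv(2)[OF c, symmetric])
    also have "\<dots> \<le> (\<integral>x. min m (a / 2 * x + (b + a / 2)) \<partial>\<mu>)"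
    proof (rule integral_mono[OF inv(1)[OF c] int])
      fix x show "avg (\<lambda>x. min m (a * x + b)) (x + 1) \<le> min m (a / 2 * x + (b + a / 2))"
        using avg_min_affine_le[of m a b "x + 1"] by (simp add: field_simps)
    qed (use that in auto)
    finally show ?thesis .
  qed
  have iter: "(\<integral>x. min m x \<partial>\<mu>) \<le> (\<integral>x. min m ((1 / 2) ^ k * x + (1 - (1 / 2) ^ k)) \<partial>\<mu>)"
    if "0 \<le> m" for m :: real and k
  proof (induction k)
    case (Suc k)
    have "(1 / 2 :: real) ^ k \<le> 1" by (rule power_le_one) auto
    then show ?case
      using Suc halve[of "(1 / 2) ^ k" "1 - (1 / 2) ^ k" m] that by (simp add: algebra_simps)
  qed simp
  have le1: "(\<integral>x. min m x \<partial>\<mu>) \<le> 1" if m: "1 \<le> m" for m :: real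
  proof (rule LIMSEQ_le_const)
    have "(\<lambda>k. \<integral>x. min m ((1 / 2) ^ k * x + (1 - (1 / 2) ^ k)) \<partial>\<mu>) \<longlonglongrightarrow> (\<integral>x. 1 \<partial>\<mu>)"
    proof (rule integral_dominated_convergence[where w = "\<lambda>_. m"])
      have "(\<lambda>k. min m ((1 / 2) ^ k * x + (1 - (1 / 2) ^ k))) \<longlonglongrightarrow> min m (0 * x + (1 - 0))" for x :: real
        by (intro tendsto_intros LIMSEQ_realpow_zero) auto
      then show "AE x in \<mu>. (\<lambda>k. min m ((1 / 2) ^ k * x + (1 - (1 / 2) ^ k))) \<longlonglongrightarrow> 1"
        using m by simp
      fix k :: nat
      have "(1 / 2 :: real) ^ k \<le> 1" by (rule power_le_one) auto
      then show "AE x in \<mu>. norm (min m ((1 / 2) ^ k * x + (1 - (1 / 2) ^ k))) \<le> m"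
        using nn m by auto
    qed auto
    then show "(\<lambda>k. \<integral>x. min m ((1 / 2) ^ k * x + (1 - (1 / 2) ^ k)) \<partial>\<mu>) \<longlonglongrightarrow> 1"
      by (simp add: prob_space)
    show "\<exists>N. \<forall>k\<ge>N. (\<integral>x. min m x \<partial>\<mu>) \<le> (\<integral>x. min m ((1 / 2) ^ k * x + (1 - (1 / 2) ^ k)) \<partial>\<mu>)"
      using iter m by auto
  qed
  let ?f = "\<lambda>(i :: nat) x. min (real i + 1) x"
  have fi: "integrable \<mu> (?f i)" for i using int[of 1 0 "real i + 1"] by simp
  have mono: "?f i x \<le> ?f j x" if "i \<le> j" for i j and x :: real using that by auto
  have "incseq (\<lambda>i. \<integral>x. ?f i x \<partial>\<mu>)"
    by (intro incseq_SucI integral_mono fi mono) auto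
  moreover have "(\<integral>x. ?f i x \<partial>\<mu>) \<le> 1" for i using le1[of "real i + 1"] by simp
  ultimately obtain l where l: "(\<lambda>i. \<integral>x. ?f i x \<partial>\<mu>) \<longlonglongrightarrow> l"
    by (metis incseq_convergent)
  show ?thesis
  proof (rule integrable_monotone_convergence[OF fi _ _ l])
    show "AE x in \<mu>. mono (\<lambda>i. ?f i x)" using mono by (auto simp: mono_def)
    have "(\<lambda>i. ?f i x) \<longlonglongrightarrow> x" for x :: real
    proof (rule tendsto_eventually)
      show "\<forall>\<^sub>F i in sequentially. ?f i x = x"
        using eventually_ge_at_top[of "nat \<lceil>x\<rceil>"] by eventually_elim linarith
    qed
    then show "AE x in \<mu>. (\<lambda>i. ?f i x) \<longlonglongrightarrow> x" by simp
  qed measurable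
qed

section \<open>Comparison with the Dickman law\<close>

text \<open>
  The bound \<open>L * K\<close> on the Stein functional of \<open>X\<close> is to be read as follows: \<open>X\<close> nearly satisfies
  \<open>E [X f' X] = E [f (X + 1) - f X]\<close>, the identity that characterises the Dickman law. The error
  term \<open>a * C / 2 ^ m\<close> in the induction is what remains after \<open>m\<close> replacements of \<open>h\<close> by
  \<open>T h x = avg h (x + 1)\<close>; each of them keeps the integral against \<open>\<mu>\<close>. The first replacement
  changes the integral against the law of \<open>X\<close> by at most \<open>(b / 3) * K\<close> and leaves a function with
  \<open>b / 3\<close> in place of \<open>b\<close>; the term \<open>b * K / 2\<close> is reproduced, because
  \<open>(b / 3) * K + (b / 3) * K / 2 = b * K / 2\<close>.
\<close>
lemma dickman_stein_bound:
  assumes \<mu>: "dickman_law 1 \<mu>" and M: "prob_space M" and X: "integrable M X" and K: "0 \<le> K"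
    and stein: "\<And>a L f f'. C11 a L f f' \<Longrightarrow>
      \<bar>(\<integral>\<omega>. f' (X \<omega>) * X \<omega> \<partial>M) - ((\<integral>\<omega>. f (X \<omega> + 1) \<partial>M) - (\<integral>\<omega>. f (X \<omega>) \<partial>M))\<bar> \<le> L * K"
    and h: "C11 a b h h'"
  shows "\<bar>(\<integral>x. h x \<partial>\<mu>) - (\<integral>\<omega>. h (X \<omega>) \<partial>M)\<bar> \<le> b * K / 2"
proof -
  interpret M: prob_space M by fact
  interpret \<mu>: prob_space \<mu> using \<mu> unfolding dickman_law_def by auto
  note I = dickman_integrable[OF \<mu>]
  let ?E = "\<lambda>h. \<integral>\<omega>. h (X \<omega>) \<partial>M"
  define C where "C = (\<integral>x. \<bar>x\<bar> \<partial>\<mu>) + (\<integral>\<omega>. \<bar>X \<omega>\<bar> \<partial>M)"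
  have iter: "\<bar>(\<integral>x. h x \<partial>\<mu>) - ?E h\<bar> \<le> b * K / 2 + a * C / 2 ^ m" if "C11 a b h h'" for a b h h' m
    using that
  proof (induction m arbitrary: a b h h')
    case 0
    note h = 0
    \<comment> \<open>Both expectations are close to \<open>h 0\<close>, up to the Lipschitz constant times a first absolute moment.\<close>
    have bd: "\<bar>(\<integral>\<omega>. h (Z \<omega>) \<partial>Q) - h 0\<bar> \<le> a * (\<integral>\<omega>. \<bar>Z \<omega>\<bar> \<partial>Q)"
      if Q: "prob_space Q" and Z: "integrable Q Z" for Q :: "'z measure" and Z
    proof -
      interpret Q: prob_space Q by fact
      have "(\<integral>\<omega>. h (Z \<omega>) \<partial>Q) - h 0 = (\<integral>\<omega>. h (Z \<omega>) - h 0 \<partial>Q)"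
        using C11_integrable(1)[OF h Q Z] by (simp add: Q.prob_space)
      also have "\<bar>\<dots>\<bar> \<le> (\<integral>\<omega>. \<bar>h (Z \<omega>) - h 0\<bar> \<partial>Q)" by (rule integral_abs_bound)
      also have "\<dots> \<le> (\<integral>\<omega>. a * \<bar>Z \<omega>\<bar> \<partial>Q)"
        using C11_integrable(1)[OF h Q Z] Z C11_lipschitz[OF h, of _ 0]
        by (intro integral_mono) auto
      finally show ?thesis by simp
    qed
    have "0 \<le> b * K / 2" using C11_nonneg[OF h] K by simp
    moreover have "\<bar>(\<integral>x. h x \<partial>\<mu>) - h 0\<bar> \<le> a * (\<integral>x. \<bar>x\<bar> \<partial>\<mu>)"
      using bd[OF _ I] by (simp add: \<mu>.prob_space_axioms)
    moreover have "\<bar>?E h - h 0\<bar> \<le> a * (\<integral>\<omega>. \<bar>X \<omega>\<bar> \<partial>M)" by (rule bd[OF M X])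
    ultimately show ?case by (simp add: C_def algebra_simps)
  next
    case (Suc m)
    note h = Suc.prems
    note f = C11_avg[OF h]
    note Th = C11_shift[OF f, of 1]
    have "integrable \<mu> h" by (rule C11_integrable(1)[OF h \<mu>.prob_space_axioms I])
    then have "(\<integral>x. h x \<partial>\<mu>) = (\<integral>x. avg h (x + 1) \<partial>\<mu>)"
      using dickman_invariance(2)[OF \<mu> C11_continuous(1)[OF h]] by simp
    moreover have "\<bar>(\<integral>x. avg h (x + 1) \<partial>\<mu>) - ?E (\<lambda>x. avg h (x + 1))\<bar>
        \<le> b / 3 * K / 2 + a / 2 * C / 2 ^ m"
      by (rule Suc.IH[OF Th])
    moreover have "?E h - ?E (\<lambda>x. avg h (x + 1)) =
        (\<integral>\<omega>. wavg h' (X \<omega>) * X \<omega> \<partial>M) - (?E (\<lambda>x. avg h (x + 1)) - ?E (avg h))"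
    proof -
      have "?E h = (\<integral>\<omega>. avg h (X \<omega>) + wavg h' (X \<omega>) * X \<omega> \<partial>M)"
        by (subst avg_identity[OF h]) (simp add: mult.commute)
      also have "\<dots> = ?E (avg h) + (\<integral>\<omega>. wavg h' (X \<omega>) * X \<omega> \<partial>M)"
        using C11_integrable[OF f M X] by (intro Bochner_Integration.integral_add)
      finally show ?thesis by simp
    qed
    then have "\<bar>?E h - ?E (\<lambda>x. avg h (x + 1))\<bar> \<le> b / 3 * K" using stein[OF f] by (simp only: times_divide_eq_left)
    ultimately have "\<bar>(\<integral>x. h x \<partial>\<mu>) - ?E h\<bar>
        \<le> (b / 3 * K / 2 + a / 2 * C / 2 ^ m) + b / 3 * K"
      by linarith
    also have "\<dots> = b * K / 2 + a * C / 2 ^ Suc m" by (simp add: field_simps)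
    finally show ?case .
  qed
  have "(\<lambda>m. b * K / 2 + a * C * (1 / 2) ^ m) \<longlonglongrightarrow> b * K / 2 + a * C * 0"
    by (intro tendsto_intros LIMSEQ_realpow_zero) auto
  moreover have "\<bar>(\<integral>x. h x \<partial>\<mu>) - ?E h\<bar> \<le> b * K / 2 + a * C * (1 / 2) ^ m" for m
    using iter[OF h, of m] by (simp add: power_divide)
  ultimately show ?thesis using LIMSEQ_le_const by fastforce
qed

section \<open>Moments and independence\<close>

lemma integral_norm_le_AE:
  fixes f :: "'a \<Rightarrow> real"
  assumes "integrable M f" "integrable M g" "AE x in M. norm (f x) \<le> g x"
  shows "norm (integral\<^sup>L M f) \<le> integral\<^sup>L M g"
  by (rule order_trans[OF integral_norm_bound integral_mono_AE]) (use assms in auto)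

lemma (in prob_space) expectation_abs_mult_le:
  fixes X Y :: "'a \<Rightarrow> real"
  assumes [measurable]: "X \<in> borel_measurable M" "Y \<in> borel_measurable M"
    and X: "integrable M (\<lambda>\<omega>. (X \<omega>)\<^sup>2)" and Y: "integrable M (\<lambda>\<omega>. (Y \<omega>)\<^sup>2)"
  shows "integrable M (\<lambda>\<omega>. X \<omega> * Y \<omega>)"
    "expectation (\<lambda>\<omega>. \<bar>X \<omega> * Y \<omega>\<bar>) \<le> sqrt (expectation (\<lambda>\<omega>. (X \<omega>)\<^sup>2) * expectation (\<lambda>\<omega>. (Y \<omega>)\<^sup>2))"
proof -
  show int: "integrable M (\<lambda>\<omega>. X \<omega> * Y \<omega>)"
  proof (rule Bochner_Integration.integrable_bound)
    show "integrable M (\<lambda>\<omega>. (X \<omega>)\<^sup>2 + (Y \<omega>)\<^sup>2)" using X Y by simp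
    have "\<bar>x * y\<bar> \<le> x\<^sup>2 + y\<^sup>2" for x y :: real
    proof -
      have "2 * (\<bar>x\<bar> * \<bar>y\<bar>) \<le> x\<^sup>2 + y\<^sup>2"
        using sum_squares_bound[of "\<bar>x\<bar>" "\<bar>y\<bar>"] by (simp add: mult.assoc)
      moreover have "0 \<le> \<bar>x\<bar> * \<bar>y\<bar>" by simp
      ultimately show ?thesis by (simp only: abs_mult)
    qed
    then show "AE \<omega> in M. norm (X \<omega> * Y \<omega>) \<le> norm ((X \<omega>)\<^sup>2 + (Y \<omega>)\<^sup>2)" by simp
  qed measurable
  have "(\<integral>\<^sup>+\<omega>. ennreal \<bar>X \<omega>\<bar> * ennreal \<bar>Y \<omega>\<bar> \<partial>M)\<^sup>2
      \<le> (\<integral>\<^sup>+\<omega>. (ennreal \<bar>X \<omega>\<bar>)\<^sup>2 \<partial>M) * (\<integral>\<^sup>+\<omega>. (ennreal \<bar>Y \<omega>\<bar>)\<^sup>2 \<partial>M)"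
    by (rule Cauchy_Schwarz_nn_integral) measurable
  moreover have "(\<integral>\<^sup>+\<omega>. ennreal \<bar>X \<omega>\<bar> * ennreal \<bar>Y \<omega>\<bar> \<partial>M) = ennreal (expectation (\<lambda>\<omega>. \<bar>X \<omega> * Y \<omega>\<bar>))"
    using int by (subst nn_integral_eq_integral[symmetric]) (auto simp flip: abs_mult ennreal_mult)
  moreover have "(\<integral>\<^sup>+\<omega>. (ennreal \<bar>Z \<omega>\<bar>)\<^sup>2 \<partial>M) = ennreal (expectation (\<lambda>\<omega>. (Z \<omega>)\<^sup>2))"
    if "integrable M (\<lambda>\<omega>. (Z \<omega>)\<^sup>2)" for Z :: "'a \<Rightarrow> real"
    using that by (subst nn_integral_eq_integral[symmetric]) (auto simp: ennreal_power)
  ultimately have "ennreal ((expectation (\<lambda>\<omega>. \<bar>X \<omega> * Y \<omega>\<bar>))\<^sup>2)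
      \<le> ennreal (expectation (\<lambda>\<omega>. (X \<omega>)\<^sup>2) * expectation (\<lambda>\<omega>. (Y \<omega>)\<^sup>2))"
    using X Y by (simp add: ennreal_power ennreal_mult integral_nonneg_AE)
  then show "expectation (\<lambda>\<omega>. \<bar>X \<omega> * Y \<omega>\<bar>) \<le> sqrt (expectation (\<lambda>\<omega>. (X \<omega>)\<^sup>2) * expectation (\<lambda>\<omega>. (Y \<omega>)\<^sup>2))"
    by (intro real_le_rsqrt) (simp add: integral_nonneg_AE)
qed

text \<open>
  The blocks \<open>{i}\<close>, \<open>{j}\<close> and \<open>I - {i, j}\<close> of an independent family are independent of each other,
  and so are functions of the blocks. For the weighted sum, the blocks are one Bernoulli variable,
  its weight and the variables of all other summands.
\<close>
lemma (in prob_space) expectation_indep_split: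
  fixes Z :: "'i \<Rightarrow> 'a \<Rightarrow> real" and g p :: "real \<Rightarrow> real" and \<psi> :: "('i \<Rightarrow> real) \<Rightarrow> real"
  assumes ind: "indep_vars (\<lambda>_. borel) Z I" and ij: "i \<in> I" "j \<in> I" "i \<noteq> j"
    and [measurable]: "g \<in> borel_measurable borel" "p \<in> borel_measurable borel"
      "\<psi> \<in> borel_measurable (PiM (I - {i, j}) (\<lambda>_. borel))"
    and int: "integrable M (\<lambda>\<omega>. g (Z i \<omega>))" "integrable M (\<lambda>\<omega>. p (Z j \<omega>))"
      "integrable M (\<lambda>\<omega>. \<psi> (\<lambda>l\<in>I - {i, j}. Z l \<omega>))"
  shows "integrable M (\<lambda>\<omega>. g (Z i \<omega>) * p (Z j \<omega>) * \<psi> (\<lambda>l\<in>I - {i, j}. Z l \<omega>))"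
    "expectation (\<lambda>\<omega>. g (Z i \<omega>) * p (Z j \<omega>) * \<psi> (\<lambda>l\<in>I - {i, j}. Z l \<omega>)) =
      expectation (\<lambda>\<omega>. g (Z i \<omega>)) * expectation (\<lambda>\<omega>. p (Z j \<omega>)) *
      expectation (\<lambda>\<omega>. \<psi> (\<lambda>l\<in>I - {i, j}. Z l \<omega>))"
proof -
  define K where "K b = (if b = 0 then {i} else if b = 1 then {j} else I - {i, j})" for b :: nat
  define F where "F b z = (if b = 0 then g (z i) else if b = 1 then p (z j) else \<psi> z)"
    for b :: nat and z
  define R where "R b \<omega> = F b (restrict (\<lambda>l. Z l \<omega>) (K b))" for b \<omega>
  have "indep_vars (\<lambda>b. PiM (K b) (\<lambda>_. borel)) (\<lambda>b \<omega>. restrict (\<lambda>l. Z l \<omega>) (K b)) {0, 1, 2}"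
    by (rule indep_vars_restrict[OF ind]) (use ij in \<open>auto simp: K_def disjoint_family_on_def\<close>)
  then have R: "indep_vars (\<lambda>_. borel) R {0, 1, 2}"
    unfolding R_def[abs_def]
  proof (rule indep_vars_compose2)
    fix b :: nat assume "b \<in> {0, 1, 2}"
    then consider "b = 0" | "b = 1" | "b = 2" by auto
    then show "F b \<in> borel_measurable (PiM (K b) (\<lambda>_. borel))"
      by cases (simp_all add: F_def[abs_def] K_def)
  qed
  have R_simps: "R 0 \<omega> = g (Z i \<omega>)" "R 1 \<omega> = p (Z j \<omega>)" "R 2 \<omega> = \<psi> (\<lambda>l\<in>I - {i, j}. Z l \<omega>)" for \<omega>
    by (simp_all add: R_def F_def K_def)
  have Rint: "integrable M (R b)" if "b \<in> {0, 1, 2}" for b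
  proof -
    from that consider "b = 0" | "b = 1" | "b = 2" by auto
    then show ?thesis by cases (simp_all add: R_simps[abs_def] R_simps(2)[unfolded One_nat_def, abs_def] int)
  qed
  have prod: "(\<Prod>b\<in>{0, 1, 2 :: nat}. f b) = f 0 * f 1 * f 2" for f :: "nat \<Rightarrow> real"
    by (simp add: mult.assoc)
  note * = indep_vars_integrable[OF _ R Rint] indep_vars_lebesgue_integral[OF _ R Rint]
  show "integrable M (\<lambda>\<omega>. g (Z i \<omega>) * p (Z j \<omega>) * \<psi> (\<lambda>l\<in>I - {i, j}. Z l \<omega>))"
    using *(1) unfolding prod R_simps by simp
  show "expectation (\<lambda>\<omega>. g (Z i \<omega>) * p (Z j \<omega>) * \<psi> (\<lambda>l\<in>I - {i, j}. Z l \<omega>)) =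
      expectation (\<lambda>\<omega>. g (Z i \<omega>)) * expectation (\<lambda>\<omega>. p (Z j \<omega>)) *
      expectation (\<lambda>\<omega>. \<psi> (\<lambda>l\<in>I - {i, j}. Z l \<omega>))"
    using *(2) unfolding prod R_simps by simp
qed

lemma (in prob_space) bernoulli_distr_facts:
  fixes B :: "'a \<Rightarrow> real"
  assumes B [measurable]: "B \<in> borel_measurable M" and p: "0 \<le> p" "p \<le> 1"
    and d: "distr M borel B = distr (measure_pmf (bernoulli_pmf p)) borel of_bool"
  shows "AE \<omega> in M. B \<omega> = 0 \<or> B \<omega> = 1" "integrable M B" "expectation B = p"
proof -
  have "AE x in distr (measure_pmf (bernoulli_pmf p)) borel of_bool. x = 0 \<or> x = (1 :: real)"
    by (subst AE_distr_iff) auto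
  then have "AE x in distr M borel B. x = 0 \<or> x = 1" unfolding d .
  then show *: "AE \<omega> in M. B \<omega> = 0 \<or> B \<omega> = 1" by (subst (asm) AE_distr_iff) auto
  then show "integrable M B" by (intro integrable_const_bound[where B = 1]) auto
  have "expectation B = (\<integral>x. x \<partial>distr M borel B)" by (simp add: integral_distr)
  also have "\<dots> = p" unfolding d using p by (subst integral_distr) auto
  finally show "expectation B = p" .
qed

section \<open>The Stein functional of a weighted Bernoulli sum\<close>

text \<open>
  In the language of size-biasing, \<open>E [W f' W]\<close> is the mean of \<open>f'\<close> at the size-biased version of
  \<open>W\<close>, obtained by picking an index \<open>k\<close> uniformly, setting \<open>B k = 1\<close> and size-biasing \<open>Y k\<close>; the
  increment of \<open>f\<close> is the mean of \<open>f'\<close> at \<open>W + U\<close>. The estimate couples the two by placing \<open>U\<close> in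
  the interval from \<open>(k - 1) / n\<close> to \<open>k / n\<close>.
\<close>
lemma (in prob_space) weighted_sum_stein:
  fixes n :: nat and B Y :: "nat \<Rightarrow> 'a \<Rightarrow> real" and \<sigma> :: "nat \<Rightarrow> real" and W :: "'a \<Rightarrow> real"
  assumes n: "1 \<le> n"
    and indep: "indep_vars (\<lambda>_. borel)
                  (\<lambda>i. case i of Inl k \<Rightarrow> B k | Inr k \<Rightarrow> Y k) ({1..n} <+> {1..n})"
    and B: "\<And>k. k \<in> {1..n} \<Longrightarrow>
              distr M borel (B k) = distr (measure_pmf (bernoulli_pmf (1 / real k))) borel of_bool"
    and Y_nonneg: "\<And>k. k \<in> {1..n} \<Longrightarrow> AE \<omega> in M. 0 \<le> Y k \<omega>"
    and Y_sq: "\<And>k. k \<in> {1..n} \<Longrightarrow> integrable M (\<lambda>\<omega>. (Y k \<omega>)\<^sup>2)"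
    and Y_mean: "\<And>k. k \<in> {1..n} \<Longrightarrow> expectation (Y k) = real k"
    and Y_var: "\<And>k. k \<in> {1..n} \<Longrightarrow> variance (Y k) = (\<sigma> k)\<^sup>2"
    and W: "W = (\<lambda>\<omega>. 1 / real n * (\<Sum>k=1..n. Y k \<omega> * B k \<omega>))"
  shows "integrable M W" "AE \<omega> in M. 0 \<le> W \<omega>"
    "\<And>a L f f'. C11 a L f f' \<Longrightarrow>
      \<bar>(\<integral>\<omega>. f' (W \<omega>) * W \<omega> \<partial>M) - ((\<integral>\<omega>. f (W \<omega> + 1) \<partial>M) - (\<integral>\<omega>. f (W \<omega>) \<partial>M))\<bar>
        \<le> L * (3 / (2 * real n) +
           1 / (real n)\<^sup>2 * (\<Sum>k=1..n. 1 / real k * sqrt (((\<sigma> k)\<^sup>2 + (real k)\<^sup>2) * (\<sigma> k)\<^sup>2)))"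
proof -
  let ?Z = "\<lambda>i. case i of Inl k \<Rightarrow> B k | Inr k \<Rightarrow> Y k"
  let ?I = "{1..n} <+> {1..n}"
  let ?rest = "\<lambda>k \<omega>. \<lambda>i\<in>?I - {Inl k, Inr k}. ?Z i \<omega>"
  define s where "s k = sqrt (((\<sigma> k)\<^sup>2 + (real k)\<^sup>2) * (\<sigma> k)\<^sup>2)" for k
  have rv: "?Z i \<in> borel_measurable M" if "i \<in> ?I" for i
    using indep that unfolding indep_vars_def by blast
  have mB [measurable]: "B k \<in> borel_measurable M" if "k \<in> {1..n}" for k
    using rv[OF InlI[OF that]] by simp
  have mY [measurable]: "Y k \<in> borel_measurable M" if "k \<in> {1..n}" for k
    using rv[OF InrI[OF that]] by simp
  have bern: "AE \<omega> in M. B k \<omega> = 0 \<or> B k \<omega> = 1" "integrable M (B k)" "expectation (B k) = 1 / real k"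
    if "k \<in> {1..n}" for k
    using bernoulli_distr_facts[OF mB[OF that] _ _ B[OF that]] that by auto
  have Y_int: "integrable M (Y k)" if "k \<in> {1..n}" for k
    by (rule square_integrable_imp_integrable[OF mY[OF that] Y_sq[OF that]])
  have factor: "integrable M (\<lambda>\<omega>. B k \<omega> * p (Y k \<omega>) * \<psi> (?rest k \<omega>))"
    "expectation (\<lambda>\<omega>. B k \<omega> * p (Y k \<omega>) * \<psi> (?rest k \<omega>))
      = 1 / real k * expectation (\<lambda>\<omega>. p (Y k \<omega>)) * expectation (\<lambda>\<omega>. \<psi> (?rest k \<omega>))"
    if k: "k \<in> {1..n}" and p: "p \<in> borel_measurable borel"
      and \<psi>: "\<psi> \<in> borel_measurable (PiM (?I - {Inl k, Inr k}) (\<lambda>_. borel))"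
      and ip: "integrable M (\<lambda>\<omega>. p (Y k \<omega>))" and i\<psi>: "integrable M (\<lambda>\<omega>. \<psi> (?rest k \<omega>))" for k p \<psi>
  proof -
    have mem: "Inl k \<in> ?I" "Inr k \<in> ?I" using k by auto
    have int: "integrable M (?Z (Inl k))" "integrable M (\<lambda>\<omega>. p (?Z (Inr k) \<omega>))"
      using bern(2)[OF k] ip by simp_all
    note split = expectation_indep_split[where g = "\<lambda>x. x" and p = p and \<psi> = \<psi> and Z = ?Z
        and I = ?I and i = "Inl k" and j = "Inr k", OF indep mem Inl_not_Inr
        measurable_ident_sets[OF refl] p \<psi> int i\<psi>]
    have "integrable M (\<lambda>\<omega>. ?Z (Inl k) \<omega> * p (?Z (Inr k) \<omega>) * \<psi> (?rest k \<omega>))"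
      by (fact split(1))
    moreover have "expectation (\<lambda>\<omega>. ?Z (Inl k) \<omega> * p (?Z (Inr k) \<omega>) * \<psi> (?rest k \<omega>))
        = expectation (?Z (Inl k)) * expectation (\<lambda>\<omega>. p (?Z (Inr k) \<omega>))
          * expectation (\<lambda>\<omega>. \<psi> (?rest k \<omega>))"
      by (fact split(2))
    ultimately show "integrable M (\<lambda>\<omega>. B k \<omega> * p (Y k \<omega>) * \<psi> (?rest k \<omega>))"
      "expectation (\<lambda>\<omega>. B k \<omega> * p (Y k \<omega>) * \<psi> (?rest k \<omega>))
        = 1 / real k * expectation (\<lambda>\<omega>. p (Y k \<omega>)) * expectation (\<lambda>\<omega>. \<psi> (?rest k \<omega>))"
      by (simp_all only: sum.case bern(3)[OF k])
  qed
  have BY_int: "integrable M (\<lambda>\<omega>. B k \<omega> * p (Y k \<omega>))"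
    and BY_exp: "expectation (\<lambda>\<omega>. B k \<omega> * p (Y k \<omega>)) = 1 / real k * expectation (\<lambda>\<omega>. p (Y k \<omega>))"
    if k: "k \<in> {1..n}" and p: "p \<in> borel_measurable borel"
      and ip: "integrable M (\<lambda>\<omega>. p (Y k \<omega>))" for k p
  proof -
    have c: "integrable M (\<lambda>\<omega>. (\<lambda>_. 1 :: real) (?rest k \<omega>))" by simp
    note F = factor[OF k p borel_measurable_const ip c]
    show "integrable M (\<lambda>\<omega>. B k \<omega> * p (Y k \<omega>))" using F(1) by (simp only: mult_1_right)
    show "expectation (\<lambda>\<omega>. B k \<omega> * p (Y k \<omega>)) = 1 / real k * expectation (\<lambda>\<omega>. p (Y k \<omega>))"
      using F(2) by (simp only: mult_1_right lebesgue_integral_const prob_space scaleR_one)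
  qed
  have W_int: "integrable M W"
    unfolding W
  proof (intro integrable_mult_right Bochner_Integration.integrable_sum)
    fix k assume "k \<in> {1..n}"
    from BY_int[OF this measurable_ident_sets[OF refl] Y_int[OF this]]
    show "integrable M (\<lambda>\<omega>. Y k \<omega> * B k \<omega>)" by (simp add: mult.commute)
  qed
  then show "integrable M W" .
  have YB_nonneg: "AE \<omega> in M. 0 \<le> Y k \<omega> * B k \<omega>" if "k \<in> {1..n}" for k
    using Y_nonneg[OF that] bern(1)[OF that] by eventually_elim auto
  have "AE \<omega> in M. \<forall>k\<in>{1..n}. 0 \<le> Y k \<omega> * B k \<omega>"
    using YB_nonneg by (intro AE_finite_allI) auto
  then show "AE \<omega> in M. 0 \<le> W \<omega>"
    unfolding W by eventually_elim (auto intro!: divide_nonneg_nonneg sum_nonneg)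
  fix a L :: real and f f' :: "real \<Rightarrow> real"
  assume f: "C11 a L f f'"
  note [measurable] = C11_measurable[OF f] borel_measurable_integrable[OF W_int]
  have L: "0 \<le> L" by (rule C11_nonneg(2)[OF f])
  have a: "\<bar>f' x\<bar> \<le> a" for x using f by (simp add: C11_def)
  have lip: "\<bar>f' x - f' y\<bar> \<le> L * \<bar>x - y\<bar>" for x y using f by (simp add: C11_def)
  have Wc: "integrable M (\<lambda>\<omega>. W \<omega> + c)" for c using W_int by simp
  note fW_int = C11_integrable(1)[OF f prob_space_axioms Wc]
  \<comment> \<open>\<open>V k\<close> is \<open>W\<close> without its \<open>k\<close>-th summand, hence independent of \<open>B k\<close> and \<open>Y k\<close>.
    \<open>F\<close> interpolates between \<open>E f W\<close> at \<open>k = 0\<close> and \<open>E f (W + 1)\<close> at \<open>k = n\<close>.\<close>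
  define V where "V k \<omega> = W \<omega> - Y k \<omega> * B k \<omega> / real n" for k \<omega>
  define F where "F k = expectation (\<lambda>\<omega>. f (W \<omega> + real k / real n))" for k
  have V_meas [measurable]: "V k \<in> borel_measurable M" if "k \<in> {1..n}" for k
    unfolding V_def[abs_def] using mB[OF that] mY[OF that] by measurable
  have f'V_int: "integrable M (\<lambda>\<omega>. f' (V k \<omega> + c))" if "k \<in> {1..n}" for k c
    using V_meas[OF that] a by (intro integrable_const_bound[where B = a]) auto
  \<comment> \<open>Under the weight \<open>Y k * B k\<close>, only \<open>B k = 1\<close> counts, where \<open>W\<close> and \<open>V k + k / n\<close> differ by
    \<open>(Y k - k) / n\<close>. The weighted mean of \<open>f' (V k + k / n)\<close> is the plain one by independence.\<close>
  have step1: "\<bar>expectation (\<lambda>\<omega>. f' (W \<omega>) * (Y k \<omega> * B k \<omega>))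
        - expectation (\<lambda>\<omega>. f' (V k \<omega> + real k / real n))\<bar> \<le> L * (s k / (real k * real n))"
    and YBf_int: "integrable M (\<lambda>\<omega>. f' (W \<omega>) * (Y k \<omega> * B k \<omega>))"
    if k: "k \<in> {1..n}" for k
  proof -
    note [measurable] = mB[OF k] mY[OF k] V_meas[OF k]
    have k0: "0 < real k" "0 < real n" using k by auto
    \<comment> \<open>\<open>f' (V k + k / n)\<close> as a function of the coordinates other than \<open>B k\<close> and \<open>Y k\<close>.\<close>
    define \<psi> where "\<psi> z = f' (1 / real n * (\<Sum>l\<in>{1..n} - {k}. z (Inr l) * z (Inl l)) + real k / real n)" for z
    have \<psi>: "\<psi> \<in> borel_measurable (PiM (?I - {Inl k, Inr k}) (\<lambda>_. borel))"
    proof -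
      have "(\<lambda>z. \<Sum>l\<in>{1..n} - {k}. z (Inr l) * z (Inl l) :: real)
          \<in> borel_measurable (PiM (?I - {Inl k, Inr k}) (\<lambda>_. borel))"
        by (intro borel_measurable_sum borel_measurable_times measurable_component_singleton) auto
      then show ?thesis unfolding \<psi>_def[abs_def] by measurable
    qed
    have rest: "\<psi> (?rest k \<omega>) = f' (V k \<omega> + real k / real n)" for \<omega>
    proof -
      have "(\<Sum>l\<in>{1..n} - {k}. ?rest k \<omega> (Inr l) * ?rest k \<omega> (Inl l)) = (\<Sum>l\<in>{1..n} - {k}. Y l \<omega> * B l \<omega>)"
        by (rule sum.cong) auto
      moreover have "(\<Sum>l=1..n. Y l \<omega> * B l \<omega>) = Y k \<omega> * B k \<omega> + (\<Sum>l\<in>{1..n} - {k}. Y l \<omega> * B l \<omega>)"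
        using k by (intro sum.remove) auto
      ultimately show ?thesis unfolding \<psi>_def V_def W by (simp only:) (simp add: add_divide_distrib)
    qed
    have i\<psi>: "integrable M (\<lambda>\<omega>. \<psi> (?rest k \<omega>))" unfolding rest by (rule f'V_int[OF k])
    \<comment> \<open>The factors \<open>E (B k) = 1 / k\<close> and \<open>E (Y k) = k\<close> cancel.\<close>
    have prod_int: "integrable M (\<lambda>\<omega>. B k \<omega> * Y k \<omega> * f' (V k \<omega> + real k / real n))"
      and prod_exp: "expectation (\<lambda>\<omega>. B k \<omega> * Y k \<omega> * f' (V k \<omega> + real k / real n))
        = expectation (\<lambda>\<omega>. f' (V k \<omega> + real k / real n))"
      using factor[OF k _ \<psi> _ i\<psi>, of "\<lambda>x. x"] Y_int[OF k] Y_mean[OF k] k unfolding rest by auto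
    have sq_dev: "integrable M (\<lambda>\<omega>. (Y k \<omega> - real k)\<^sup>2)"
      using Y_sq[OF k] Y_int[OF k] by (simp add: power2_diff)
    have "expectation (\<lambda>\<omega>. (Y k \<omega>)\<^sup>2) = (\<sigma> k)\<^sup>2 + (real k)\<^sup>2"
      using variance_eq[OF Y_int[OF k] Y_sq[OF k]] Y_mean[OF k] Y_var[OF k] by simp
    moreover have "expectation (\<lambda>\<omega>. (Y k \<omega> - real k)\<^sup>2) = (\<sigma> k)\<^sup>2"
      using Y_var[OF k] unfolding Y_mean[OF k] .
    ultimately have dev: "integrable M (\<lambda>\<omega>. Y k \<omega> * (Y k \<omega> - real k))"
      "expectation (\<lambda>\<omega>. \<bar>Y k \<omega> * (Y k \<omega> - real k)\<bar>) \<le> s k"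
      using expectation_abs_mult_le[OF mY[OF k] _ Y_sq[OF k] sq_dev] by (auto simp: s_def)
    have BYdev_int: "integrable M (\<lambda>\<omega>. B k \<omega> * \<bar>Y k \<omega> * (Y k \<omega> - real k)\<bar>)"
      and BYdev_exp: "expectation (\<lambda>\<omega>. B k \<omega> * \<bar>Y k \<omega> * (Y k \<omega> - real k)\<bar>) \<le> s k / real k"
      using BY_int[OF k, of "\<lambda>y. \<bar>y * (y - real k)\<bar>"] BY_exp[OF k, of "\<lambda>y. \<bar>y * (y - real k)\<bar>"] dev k0
      by (auto simp: divide_right_mono)
    have pointwise: "AE \<omega> in M. norm (f' (W \<omega>) * (Y k \<omega> * B k \<omega>) - B k \<omega> * Y k \<omega> * f' (V k \<omega> + real k / real n))
        \<le> L / real n * (B k \<omega> * \<bar>Y k \<omega> * (Y k \<omega> - real k)\<bar>)"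
      using bern(1)[OF k]
    proof eventually_elim
      case (elim \<omega>)
      then show ?case
      proof
        assume B1: "B k \<omega> = 1"
        have eq: "f' (W \<omega>) * (Y k \<omega> * B k \<omega>) - B k \<omega> * Y k \<omega> * f' (V k \<omega> + real k / real n)
            = Y k \<omega> * (f' (W \<omega>) - f' (V k \<omega> + real k / real n))"
          using B1 by (simp add: algebra_simps)
        have "\<bar>f' (W \<omega>) - f' (V k \<omega> + real k / real n)\<bar> \<le> L * \<bar>W \<omega> - (V k \<omega> + real k / real n)\<bar>"
          by (rule lip)
        also have "W \<omega> - (V k \<omega> + real k / real n) = (Y k \<omega> - real k) / real n"
          using B1 by (simp add: V_def diff_divide_distrib)
        also have "\<bar>\<dots>\<bar> = \<bar>Y k \<omega> - real k\<bar> / real n" by simp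
        finally have "norm (f' (W \<omega>) * (Y k \<omega> * B k \<omega>) - B k \<omega> * Y k \<omega> * f' (V k \<omega> + real k / real n))
            \<le> \<bar>Y k \<omega>\<bar> * (L * (\<bar>Y k \<omega> - real k\<bar> / real n))"
          unfolding eq real_norm_def abs_mult by (rule mult_left_mono) simp
        also have "\<dots> = L / real n * (B k \<omega> * \<bar>Y k \<omega> * (Y k \<omega> - real k)\<bar>)"
          using B1 by (simp add: abs_mult)
        finally show ?thesis .
      qed simp
    qed
    have diff_int: "integrable M (\<lambda>\<omega>. f' (W \<omega>) * (Y k \<omega> * B k \<omega>) - B k \<omega> * Y k \<omega> * f' (V k \<omega> + real k / real n))"
    proof (rule Bochner_Integration.integrable_bound[OF integrable_mult_right[OF BYdev_int, of "L / real n"]])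
      show "AE \<omega> in M. norm (f' (W \<omega>) * (Y k \<omega> * B k \<omega>) - B k \<omega> * Y k \<omega> * f' (V k \<omega> + real k / real n))
          \<le> norm (L / real n * (B k \<omega> * \<bar>Y k \<omega> * (Y k \<omega> - real k)\<bar>))"
        using pointwise by eventually_elim (erule order_trans, simp only: real_norm_def abs_ge_self)
    qed measurable
    from Bochner_Integration.integrable_add[OF this prod_int]
    show int: "integrable M (\<lambda>\<omega>. f' (W \<omega>) * (Y k \<omega> * B k \<omega>))" by simp
    have "\<bar>expectation (\<lambda>\<omega>. f' (W \<omega>) * (Y k \<omega> * B k \<omega>)) - expectation (\<lambda>\<omega>. f' (V k \<omega> + real k / real n))\<bar>
        = norm (expectation (\<lambda>\<omega>. f' (W \<omega>) * (Y k \<omega> * B k \<omega>) - B k \<omega> * Y k \<omega> * f' (V k \<omega> + real k / real n)))"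
      unfolding prod_exp[symmetric] using int prod_int by simp
    also have "\<dots> \<le> expectation (\<lambda>\<omega>. L / real n * (B k \<omega> * \<bar>Y k \<omega> * (Y k \<omega> - real k)\<bar>))"
      by (rule integral_norm_le_AE[OF diff_int integrable_mult_right[OF BYdev_int] pointwise])
    also have "\<dots> \<le> L / real n * (s k / real k)"
      using BYdev_exp L by (simp only: integral_mult_right_zero) (intro mult_left_mono, auto)
    finally show "\<bar>expectation (\<lambda>\<omega>. f' (W \<omega>) * (Y k \<omega> * B k \<omega>))
        - expectation (\<lambda>\<omega>. f' (V k \<omega> + real k / real n))\<bar> \<le> L * (s k / (real k * real n))"
      by (simp add: mult.commute)
  qed
  \<comment> \<open>Up to the factor \<open>L\<close>: of the \<open>3 / (2 n)\<close>, a part \<open>1 / n\<close> pays for putting the summand \<open>Y k * B k / n\<close> of mean \<open>1 / n\<close>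
    back, and \<open>1 / (2 n)\<close> for replacing \<open>f'\<close> by a difference quotient of step \<open>1 / n\<close>.\<close>
  have step2: "\<bar>expectation (\<lambda>\<omega>. f' (V k \<omega> + real k / real n)) - real n * (F k - F (k - 1))\<bar>
      \<le> L * (3 / (2 * real n))"
    if k: "k \<in> {1..n}" for k
  proof -
    note [measurable] = mB[OF k] mY[OF k] V_meas[OF k]
    have k0: "0 < real k" "0 < real n" using k by auto
    have YB: "integrable M (\<lambda>\<omega>. Y k \<omega> * B k \<omega>)" "expectation (\<lambda>\<omega>. Y k \<omega> * B k \<omega>) = 1"
      using BY_int[OF k, of "\<lambda>x. x"] BY_exp[OF k, of "\<lambda>x. x"] Y_int[OF k] Y_mean[OF k] k0
      by (auto simp: mult.commute)
    let ?D = "\<lambda>\<omega>. f' (V k \<omega> + real k / real n)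
        - real n * (f (W \<omega> + real k / real n) - f (W \<omega> + real (k - 1) / real n))"
    have D_int: "integrable M ?D" using f'V_int[OF k] fW_int by simp
    have pointwise: "AE \<omega> in M. norm (?D \<omega>) \<le> L / real n * (Y k \<omega> * B k \<omega>) + L / (2 * real n)"
      using YB_nonneg[OF k]
    proof eventually_elim
      case (elim \<omega>)
      let ?y = "W \<omega> + real k / real n"
      have "\<bar>f' (V k \<omega> + real k / real n) - f' ?y\<bar> \<le> L * \<bar>V k \<omega> + real k / real n - ?y\<bar>"
        by (rule lip)
      also have "V k \<omega> + real k / real n - ?y = - (Y k \<omega> * B k \<omega> / real n)" by (simp add: V_def)
      also have "\<bar>\<dots>\<bar> = Y k \<omega> * B k \<omega> / real n" using elim k0 by simp
      finally have 1: "\<bar>f' (V k \<omega> + real k / real n) - f' ?y\<bar> \<le> L * (Y k \<omega> * B k \<omega> / real n)" .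
      have prev: "?y - 1 / real n = W \<omega> + real (k - 1) / real n"
        using k by (simp add: of_nat_diff diff_divide_distrib)
      have "\<bar>f ?y - f (W \<omega> + real (k - 1) / real n) - 1 / real n * f' ?y\<bar> \<le> L * (1 / real n)\<^sup>2 / 2"
        unfolding prev[symmetric] by (rule C11_taylor[OF f]) simp
      then have "real n * \<bar>f ?y - f (W \<omega> + real (k - 1) / real n) - 1 / real n * f' ?y\<bar>
          \<le> real n * (L * (1 / real n)\<^sup>2 / 2)"
        by (intro mult_left_mono) auto
      moreover have "real n * \<bar>f ?y - f (W \<omega> + real (k - 1) / real n) - 1 / real n * f' ?y\<bar>
          = \<bar>f' ?y - real n * (f ?y - f (W \<omega> + real (k - 1) / real n))\<bar>"
      proof -
        have "real n * \<bar>z\<bar> = \<bar>- (real n * z)\<bar>" for z using k0 by (simp add: abs_mult)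
        moreover have "- (real n * (f ?y - f (W \<omega> + real (k - 1) / real n) - 1 / real n * f' ?y))
            = f' ?y - real n * (f ?y - f (W \<omega> + real (k - 1) / real n))"
          using k0 by (simp add: field_simps)
        ultimately show ?thesis by metis
      qed
      moreover have "real n * (L * (1 / real n)\<^sup>2 / 2) = L / (2 * real n)"
        using k0 by (simp add: power2_eq_square)
      ultimately have 2: "\<bar>f' ?y - real n * (f ?y - f (W \<omega> + real (k - 1) / real n))\<bar> \<le> L / (2 * real n)"
        by simp
      show ?case using 1 2 by simp
    qed
    have "expectation (\<lambda>\<omega>. f' (V k \<omega> + real k / real n)) - real n * (F k - F (k - 1)) = expectation ?D"
      unfolding F_def using f'V_int[OF k] fW_int by simp
    also have "norm \<dots> \<le> expectation (\<lambda>\<omega>. L / real n * (Y k \<omega> * B k \<omega>) + L / (2 * real n))"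
      by (rule integral_norm_le_AE[OF D_int _ pointwise]) (use YB in simp)
    also have "\<dots> = L / real n * expectation (\<lambda>\<omega>. Y k \<omega> * B k \<omega>) + L / (2 * real n)"
      using YB(1) by (simp add: prob_space)
    also have "\<dots> = L * (3 / (2 * real n))" unfolding YB(2) using k0 by (simp add: field_simps)
    finally show ?thesis by simp
  qed
  have telescope: "(\<Sum>k=1..n. F k - F (k - 1)) = F n - F 0"
    using n by (induction n rule: dec_induct) auto
  have "expectation (\<lambda>\<omega>. f' (W \<omega>) * W \<omega>)
      = 1 / real n * (\<Sum>k=1..n. expectation (\<lambda>\<omega>. f' (W \<omega>) * (Y k \<omega> * B k \<omega>)))"
  proof -
    have "f' (W \<omega>) * W \<omega> = 1 / real n * (\<Sum>k=1..n. f' (W \<omega>) * (Y k \<omega> * B k \<omega>))" for \<omega>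
      by (simp add: W sum_distrib_left)
    then show ?thesis using YBf_int by (simp add: Bochner_Integration.integral_sum)
  qed
  moreover have "F n = expectation (\<lambda>\<omega>. f (W \<omega> + 1))" "F 0 = expectation (\<lambda>\<omega>. f (W \<omega>))"
    using n by (simp_all add: F_def)
  ultimately have "expectation (\<lambda>\<omega>. f' (W \<omega>) * W \<omega>)
        - (expectation (\<lambda>\<omega>. f (W \<omega> + 1)) - expectation (\<lambda>\<omega>. f (W \<omega>)))
      = 1 / real n * (\<Sum>k=1..n. expectation (\<lambda>\<omega>. f' (W \<omega>) * (Y k \<omega> * B k \<omega>)) - real n * (F k - F (k - 1)))"
    using n telescope by (simp add: sum_subtractf right_diff_distrib flip: sum_distrib_left)
  also have "\<bar>\<dots>\<bar> \<le> 1 / real n * (\<Sum>k=1..n. L * (s k / (real k * real n)) + L * (3 / (2 * real n)))"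
  proof -
    have "\<bar>\<Sum>k=1..n. expectation (\<lambda>\<omega>. f' (W \<omega>) * (Y k \<omega> * B k \<omega>)) - real n * (F k - F (k - 1))\<bar>
        \<le> (\<Sum>k=1..n. L * (s k / (real k * real n)) + L * (3 / (2 * real n)))"
    proof (rule order_trans[OF sum_abs sum_mono])
      fix k assume "k \<in> {1..n}"
      from step1[OF this] step2[OF this]
      show "\<bar>expectation (\<lambda>\<omega>. f' (W \<omega>) * (Y k \<omega> * B k \<omega>)) - real n * (F k - F (k - 1))\<bar>
          \<le> L * (s k / (real k * real n)) + L * (3 / (2 * real n))"
        by linarith
    qed
    then show ?thesis by (simp add: abs_mult divide_right_mono)
  qed
  also have "\<dots> = L * (3 / (2 * real n) + 1 / (real n)\<^sup>2 * (\<Sum>k=1..n. 1 / real k * s k))"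
  proof -
    have "(\<Sum>k=1..n. L * (s k / (real k * real n))) = L / real n * (\<Sum>k=1..n. 1 / real k * s k)"
      unfolding sum_distrib_left by (rule sum.cong) auto
    then have "(\<Sum>k=1..n. L * (s k / (real k * real n)) + L * (3 / (2 * real n)))
        = L / real n * (\<Sum>k=1..n. 1 / real k * s k) + real n * (L * (3 / (2 * real n)))"
      unfolding sum.distrib by simp
    moreover have "1 / real n * (L / real n * S + real n * (L * (3 / (2 * real n))))
        = L * (3 / (2 * real n) + 1 / (real n)\<^sup>2 * S)" for S
      using n by (simp add: field_simps power2_eq_square)
    ultimately show ?thesis by (simp only:)
  qed
  finally show "\<bar>(\<integral>\<omega>. f' (W \<omega>) * W \<omega> \<partial>M) - ((\<integral>\<omega>. f (W \<omega> + 1) \<partial>M) - (\<integral>\<omega>. f (W \<omega>) \<partial>M))\<bar>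
      \<le> L * (3 / (2 * real n) +
         1 / (real n)\<^sup>2 * (\<Sum>k=1..n. 1 / real k * sqrt (((\<sigma> k)\<^sup>2 + (real k)\<^sup>2) * (\<sigma> k)\<^sup>2)))"
    unfolding s_def .
qed

section \<open>The distance to the Dickman law\<close>

theorem theorem1p1:
  fixes n :: nat
    and M :: "'a measure" and B Y :: "nat \<Rightarrow> 'a \<Rightarrow> real" and \<sigma> :: "nat \<Rightarrow> real"
    and W :: "'a \<Rightarrow> real"
    and N :: "'b measure" and D :: "'b \<Rightarrow> real"
  assumes n: "1 \<le> n"
    and M: "prob_space M"
    and indep: "prob_space.indep_vars M (\<lambda>_. borel)
                  (\<lambda>i. case i of Inl k \<Rightarrow> B k | Inr k \<Rightarrow> Y k) ({1..n} <+> {1..n})"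
    and B: "\<And>k. k \<in> {1..n} \<Longrightarrow>
              distr M borel (B k) = distr (measure_pmf (bernoulli_pmf (1 / real k))) borel of_bool"
    and Y_nonneg: "\<And>k. k \<in> {1..n} \<Longrightarrow> AE \<omega> in M. 0 \<le> Y k \<omega>"
    and Y_square_integrable: "\<And>k. k \<in> {1..n} \<Longrightarrow> integrable M (\<lambda>\<omega>. (Y k \<omega>)\<^sup>2)"
    and Y_mean: "\<And>k. k \<in> {1..n} \<Longrightarrow> prob_space.expectation M (Y k) = real k"
    and Y_variance: "\<And>k. k \<in> {1..n} \<Longrightarrow> prob_space.variance M (Y k) = (\<sigma> k)\<^sup>2"
    and W: "W = (\<lambda>\<omega>. 1 / real n * (\<Sum>k=1..n. Y k \<omega> * B k \<omega>))"
    and N: "prob_space N"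
    and D: "D \<in> borel_measurable N" "dickman_law 1 (distr N borel D)"
  shows "d11 M W N D \<le> ereal (3 / (4 * real n) +
           1 / (2 * (real n)\<^sup>2) *
             (\<Sum>k=1..n. 1 / real k * sqrt (((\<sigma> k)\<^sup>2 + (real k)\<^sup>2) * (\<sigma> k)\<^sup>2)))
         \<and> ((\<forall>k\<in>{1..n}. AE \<omega> in M. Y k \<omega> = real k) \<longrightarrow>
               d11 M W N D \<le> ereal (3 / (4 * real n)))"
proof -
  interpret M: prob_space M by fact
  interpret N: prob_space N by fact
  note [measurable] = D(1)
  let ?S = "\<Sum>k=1..n. 1 / real k * sqrt (((\<sigma> k)\<^sup>2 + (real k)\<^sup>2) * (\<sigma> k)\<^sup>2)"
  let ?K = "3 / (2 * real n) + 1 / (real n)\<^sup>2 * ?S"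
  note W_facts = M.weighted_sum_stein[OF n indep B Y_nonneg Y_square_integrable Y_mean Y_variance W]
  note [measurable] = borel_measurable_integrable[OF W_facts(1)]
  have "AE x in distr N borel D. 0 \<le> x" using D(2) unfolding dickman_law_def by blast
  then have D_nonneg: "AE \<omega> in N. 0 \<le> D \<omega>" by (subst (asm) AE_distr_iff) auto
  have K: "0 \<le> ?K" by (intro add_nonneg_nonneg mult_nonneg_nonneg sum_nonneg) auto
  have main: "d11 M W N D \<le> ereal (?K / 2)"
    unfolding d11_def
  proof (rule SUP_least)
    fix h assume "h \<in> H_class 1 1"
    then obtain g g' where g: "C11 1 1 g g'" and gh: "\<And>x. 0 \<le> x \<Longrightarrow> g x = h x"
      by (rule H_class_extends) blast
    have [measurable]: "g \<in> borel_measurable borel" by (rule C11_measurable(1)[OF g])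
    have "h = (\<lambda>x. if 0 \<le> x then g x else undefined)"
      using \<open>h \<in> H_class 1 1\<close> gh unfolding H_class_def by (auto simp: extensional_def fun_eq_iff)
    then have [measurable]: "h \<in> borel_measurable borel" by simp
    have "(\<integral>\<omega>. h (D \<omega>) \<partial>N) = (\<integral>\<omega>. g (D \<omega>) \<partial>N)"
      by (rule integral_cong_AE) (use D_nonneg gh in auto)
    also have "\<dots> = (\<integral>x. g x \<partial>distr N borel D)" by (simp add: integral_distr)
    finally have "(\<integral>\<omega>. h (D \<omega>) \<partial>N) = (\<integral>x. g x \<partial>distr N borel D)" .
    moreover have "(\<integral>\<omega>. h (W \<omega>) \<partial>M) = (\<integral>\<omega>. g (W \<omega>) \<partial>M)"
      by (rule integral_cong_AE) (use W_facts(2) gh in auto)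
    ultimately show "ereal \<bar>(\<integral>\<omega>. h (D \<omega>) \<partial>N) - (\<integral>\<omega>. h (W \<omega>) \<partial>M)\<bar> \<le> ereal (?K / 2)"
      using dickman_stein_bound[OF D(2) M W_facts(1) K W_facts(3) g] by simp
  qed
  also have "?K / 2 = 3 / (4 * real n) + 1 / (2 * (real n)\<^sup>2) * ?S" by (simp add: add_divide_distrib)
  finally have bound: "d11 M W N D \<le> ereal (3 / (4 * real n) + 1 / (2 * (real n)\<^sup>2) * ?S)" .
  have S_zero: "?S = 0" if Yk: "\<forall>k\<in>{1..n}. AE \<omega> in M. Y k \<omega> = real k"
  proof -
    have "(\<sigma> k)\<^sup>2 = 0" if k: "k \<in> {1..n}" for k
    proof -
      have "(\<sigma> k)\<^sup>2 = (\<integral>\<omega>. (Y k \<omega> - real k)\<^sup>2 \<partial>M)" using Y_variance[OF k] Y_mean[OF k] by simp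
      also have "\<dots> = 0" using Yk k by (intro integral_eq_zero_AE) auto
      finally show ?thesis .
    qed
    then show ?thesis by simp
  qed
  show ?thesis
  proof (intro conjI impI bound)
    assume "\<forall>k\<in>{1..n}. AE \<omega> in M. Y k \<omega> = real k"
    then show "d11 M W N D \<le> ereal (3 / (4 * real n))"
      using bound unfolding S_zero[OF \<open>\<forall>k\<in>{1..n}. AE \<omega> in M. Y k \<omega> = real k\<close>] by simp
  qed
qed

end
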